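(* Let $q$ be an odd prime power, $n\geq 3$ odd, $\xi$ a non-square in $\mathbb{F}_q$, $r$ an integer with $\gcd(n,r)=1$, $b\in\mathbb{F}_{q^n}^*$ with $N_q(b)\neq\pm1$, $H_{b,r}(x)=x-bx^{q^r}$ and $B_{b,r}(x)=2H_{b,r}^{-1}(x)-x$. Then the $\mathbb{F}_q$-linear set $$L_{\mathcal{D}_B}=\{\langle(x,y,B_{b,r}(y),\xi B_{b,r}(x))\rangle : x,y\in\mathbb{F}_{q^n},\ (x,y)\neq(0,0)\}\subset PG(3,q^n)$$ is a maximum scattered $\mathbb{F}_q$-linear set of pseudoregulus type whose two transversal lines are external to the quadric $\mathcal{Q}: X_0X_3-X_1X_2=0$ and are polar to each other with respect to the polarity defined by $\mathcal{Q}$.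
   Context: $N_q$ denotes the norm from $\mathbb{F}_{q^n}$ to $\mathbb{F}_q$. For an $\mathbb{F}_q$-subspace $U$ of $\mathbb{F}_{q^n}^4$, $L_U=\{\langle\mathbf u\rangle:\mathbf u\in U\setminus\{0\}\}$ is an $\mathbb{F}_q$-linear set of rank $\dim_{\mathbb{F}_q}U$; the weight of a subspace $PG(W,\mathbb{F}_{q^n})$ in $L_U$ is $\dim_{\mathbb{F}_q}(W\cap U)$. $L_U$ is maximum scattered in $PG(3,q^n)$ if all its points have weight $1$ and its rank is $2n$; a long line is a line of weight $n$. A maximum scattered $\mathbb{F}_q$-linear set $L$ of $PG(3,q^n)$ is of pseudoregulus type if there exist $q^n+1$ pairwise disjoint long lines of $L$ and exactly two lines $T_1,T_2$ disjoint from $L$ meeting each of these long lines; $T_1,T_2$ are called the transversal lines of $L$. *)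

theory Defs
  imports "HOL-Analysis.Cartesian_Space"
begin

text \<open>
  The extension of \<open>F\<^sub>q\<close> of degree \<open>n\<close> is given by finite field types \<open>'k\<close> (of order \<open>q\<close>) and \<open>'a\<close>
  (of order \<open>q\<^sup>n\<close>) together with an embedding \<open>\<iota> :: 'k \<Rightarrow> 'a\<close>; then \<open>q = CARD('k)\<close> is automatically a prime power.
  Subspaces of \<open>PG(3,q\<^sup>n)\<close> are subspaces of \<open>'a^4\<close> in the sense of the library interpretation \<open>vec\<close>.
\<close>

definition field_embedding :: "('k::field \<Rightarrow> 'a::field) \<Rightarrow> bool" where
  "field_embedding \<iota> \<longleftrightarrow> \<iota> 1 = 1 \<and> (\<forall>x y. \<iota> (x + y) = \<iota> x + \<iota> y) \<and> (\<forall>x y. \<iota> (x * y) = \<iota> x * \<iota> y)"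

definition base_scale :: "('k::field \<Rightarrow> 'a::field) \<Rightarrow> 'k \<Rightarrow> 'a^4 \<Rightarrow> 'a^4" where
  "base_scale \<iota> c v = \<iota> c *s v"

text \<open>
  Points are the one-dimensional subspaces. For an \<open>F\<^sub>q\<close>-subspace \<open>U\<close> the following is the linear set
  \<open>L\<^sub>U\<close>; for an \<open>'a\<close>-subspace \<open>W\<close> it is the set of all points of \<open>PG(W)\<close>.
\<close>

definition linear_set :: "('a::field^4) set \<Rightarrow> ('a^4) set set" where
  "linear_set U = {vec.span {u} |u. u \<in> U - {0}}"

abbreviation (input) points :: "('a::field^4) set \<Rightarrow> ('a^4) set set" where
  "points W \<equiv> linear_set W"

definition is_line :: "('a::field^4) set \<Rightarrow> bool" where
  "is_line T \<longleftrightarrow> vec.subspace T \<and> vec.dim T = 2"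

text \<open>
  Rank and weights of a linear set refer to the subspace \<open>U\<close> defining it, so the notions below are
  predicates of \<open>U\<close> rather than of the point set \<open>L\<^sub>U\<close>.
\<close>

definition rank_of :: "('k::field \<Rightarrow> 'a::field) \<Rightarrow> ('a^4) set \<Rightarrow> nat" where
  "rank_of \<iota> U = vector_space.dim (base_scale \<iota>) U"

definition weight :: "('k::field \<Rightarrow> 'a::field) \<Rightarrow> ('a^4) set \<Rightarrow> ('a^4) set \<Rightarrow> nat" where
  "weight \<iota> U W = vector_space.dim (base_scale \<iota>) (W \<inter> U)"

definition maximum_scattered :: "('k::field \<Rightarrow> 'a::field) \<Rightarrow> nat \<Rightarrow> ('a^4) set \<Rightarrow> bool" where
  "maximum_scattered \<iota> n U \<longleftrightarrow>
     module.subspace (base_scale \<iota>) U \<and>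
     (\<forall>P\<in>linear_set U. weight \<iota> U P = 1) \<and>
     rank_of \<iota> U = 2 * n"

definition long_line :: "('k::field \<Rightarrow> 'a::field) \<Rightarrow> nat \<Rightarrow> ('a^4) set \<Rightarrow> ('a^4) set \<Rightarrow> bool" where
  "long_line \<iota> n U s \<longleftrightarrow> is_line s \<and> weight \<iota> U s = n"

definition transversal_lines ::
  "('k::field \<Rightarrow> 'a::field) \<Rightarrow> nat \<Rightarrow> ('a^4) set \<Rightarrow> ('a^4) set \<Rightarrow> ('a^4) set \<Rightarrow> bool" where
  "transversal_lines \<iota> n U T1 T2 \<longleftrightarrow>
     (\<exists>S. (\<forall>s\<in>S. long_line \<iota> n U s) \<and>
          card S = CARD('k) ^ n + 1 \<and>
          pairwise (\<lambda>s t. disjnt (points s) (points t)) S \<and>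
          T1 \<noteq> T2 \<and>
          {T. is_line T \<and> disjnt (points T) (linear_set U) \<and>
              (\<forall>s\<in>S. \<not> disjnt (points T) (points s))} = {T1, T2})"

definition pseudoregulus_type :: "('k::field \<Rightarrow> 'a::field) \<Rightarrow> nat \<Rightarrow> ('a^4) set \<Rightarrow> bool" where
  "pseudoregulus_type \<iota> n U \<longleftrightarrow>
     maximum_scattered \<iota> n U \<and> (\<exists>T1 T2. transversal_lines \<iota> n U T1 T2)"

text \<open>
  The components of \<open>'a^4\<close> are numbered from 1 (as for \<^const>\<open>vector\<close>), so the homogeneous coordinate
  \<open>X\<^sub>i\<close> is the component \<open>i + 1\<close>. In the index type, \<open>4 = 0\<close>.
\<close>

lemma vector_4_nth:
  "(vector [w, x, y, z] :: 'a::zero^4) $ 1 = w"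
  "(vector [w, x, y, z] :: 'a::zero^4) $ 2 = x"
  "(vector [w, x, y, z] :: 'a::zero^4) $ 3 = y"
  "(vector [w, x, y, z] :: 'a::zero^4) $ 4 = z"
  by (simp_all add: vector_def)

definition quadratic_form :: "'a::field^4 \<Rightarrow> 'a" where
  "quadratic_form v = v $ 1 * v $ 4 - v $ 2 * v $ 3"

definition quadric :: "('a::field^4) set set" where
  "quadric = {vec.span {v} |v. v \<noteq> 0 \<and> quadratic_form v = 0}"

definition polar_form :: "'a::field^4 \<Rightarrow> 'a^4 \<Rightarrow> 'a" where
  "polar_form u v = quadratic_form (u + v) - quadratic_form u - quadratic_form v"

definition polar_subspace :: "('a::field^4) set \<Rightarrow> ('a^4) set" where
  "polar_subspace W = {v. \<forall>w\<in>W. polar_form v w = 0}"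

definition external_line :: "('a::field^4) set \<Rightarrow> bool" where
  "external_line T \<longleftrightarrow> is_line T \<and> disjnt (points T) quadric"

text \<open>The norm to the subfield of order \<open>q\<close>, as the product of the conjugates \<open>x\<^bsup>q^i\<^esup>\<close>.\<close>

definition field_norm :: "nat \<Rightarrow> nat \<Rightarrow> 'a::field \<Rightarrow> 'a" where
  "field_norm q n x = (\<Prod>i<n. x ^ (q ^ i))"

text \<open>
  The exponent \<open>r\<close> is an arbitrary integer; for \<open>r < 0\<close> the map \<open>x \<mapsto> x\<^bsup>q^r\<^esup>\<close> is the inverse of the
  automorphism \<open>x \<mapsto> x\<^bsup>q^(-r)\<^esup>\<close>.
\<close>

definition frob :: "nat \<Rightarrow> int \<Rightarrow> 'a::field \<Rightarrow> 'a" where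
  "frob q r x = (if r \<ge> 0 then x ^ (q ^ nat r) else inv (\<lambda>y. y ^ (q ^ nat (- r))) x)"

definition H_map :: "nat \<Rightarrow> 'a::field \<Rightarrow> int \<Rightarrow> 'a \<Rightarrow> 'a" where
  "H_map q b r x = x - b * frob q r x"

definition B_map :: "nat \<Rightarrow> 'a::field \<Rightarrow> int \<Rightarrow> 'a \<Rightarrow> 'a" where
  "B_map q b r x = 2 * inv (H_map q b r) x - x"

definition D_B :: "('k::field \<Rightarrow> 'a::field) \<Rightarrow> nat \<Rightarrow> 'a \<Rightarrow> int \<Rightarrow> 'k \<Rightarrow> ('a^4) set" where
  "D_B \<iota> q b r \<xi> = {vector [x, y, B_map q b r y, \<iota> \<xi> * B_map q b r x] |x y. True}"

end

theory Submission
  imports Defs "HOL-Computational_Algebra.Polynomial"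
begin

text \<open>
  Write \<open>\<sigma>(x) = x\<^bsup>q^r\<^esup>\<close>. Substituting \<open>x = H(u)\<close> and \<open>y = H(v)\<close> turns the generic vector of \<open>D\<^sub>B\<close> into
  \<open>(u - b \<sigma>(u), v - b \<sigma>(v), v + b \<sigma>(v), \<xi> (u + b \<sigma>(u)))\<close>. Splitting the space as the direct sum of
  \<open>T\<^sub>1 = {(u, v, v, \<xi> u)}\<close> and \<open>T\<^sub>2 = {(- u, - v, v, \<xi> u)}\<close>, the set \<open>D\<^sub>B\<close> is thus the graph of the
  semilinear bijection \<open>w \<mapsto> b \<sigma>(w)\<close> from \<open>T\<^sub>1\<close> to \<open>T\<^sub>2\<close>. Such a graph is scattered because the fixed field
  of \<open>\<sigma>\<close> is \<open>F\<^sub>q\<close>; its long lines are exactly the \<open>q\<^sup>n + 1\<close> lines joining \<open>w\<close> to \<open>\<sigma>(w)\<close>, and their only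
  common transversals are \<open>T\<^sub>1\<close> and \<open>T\<^sub>2\<close>. The quadratic form is \<open>\<xi> u\<^sup>2 - v\<^sup>2\<close> on \<open>T\<^sub>1\<close> and its negative on
  \<open>T\<^sub>2\<close>, hence anisotropic because \<open>\<xi>\<close> stays a non-square in an extension of odd degree.
\<close>

subsection \<open>Finite field extensions\<close>

lemma field_embedding_simps:
  assumes "field_embedding \<iota>"
  shows "\<iota> 0 = 0" "\<iota> 1 = 1" "\<iota> (x + y) = \<iota> x + \<iota> y" "\<iota> (x * y) = \<iota> x * \<iota> y"
    "\<iota> (x - y) = \<iota> x - \<iota> y" "\<iota> (x ^ m) = \<iota> x ^ m"
proof -
  show add: "\<iota> (x + y) = \<iota> x + \<iota> y" for x y
    using assms by (simp add: field_embedding_def)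
  show mult: "\<iota> (x * y) = \<iota> x * \<iota> y" and one: "\<iota> 1 = 1" for x y
    using assms by (simp_all add: field_embedding_def)
  show "\<iota> 0 = 0"
    using add[of 0 0] by (metis add_0 add_cancel_right_right)
  show "\<iota> (x - y) = \<iota> x - \<iota> y"
    using add[of "x - y" y] by (simp add: eq_diff_eq)
  show "\<iota> (x ^ m) = \<iota> x ^ m"
    by (induction m) (simp_all add: one mult)
qed

lemma field_embedding_inj:
  assumes "field_embedding \<iota>"
  shows "inj \<iota>"
proof (rule injI)
  fix x y assume eq: "\<iota> x = \<iota> y"
  show "x = y"
  proof (rule ccontr)
    assume "x \<noteq> y"
    then have "(x - y) * inverse (x - y) = 1"
      by simp
    then have "\<iota> (x - y) * \<iota> (inverse (x - y)) = 1"
      using field_embedding_simps(2,4)[OF assms] by metis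
    then show False
      using eq by (simp add: field_embedding_simps(5)[OF assms])
  qed
qed

text \<open>Multiplication by a nonzero \<open>x\<close> permutes the nonzero elements, so their
  product absorbs the factor \<open>x ^ card ?A\<close>.\<close>

lemma power_CARD_eq_self:
  fixes x :: "'a::{field,finite}"
  shows "x ^ CARD('a) = x"
proof (cases "x = 0")
  case True
  then show ?thesis by (simp add: power_0_left)
next
  case False
  let ?A = "UNIV - {0::'a}"
  have "bij_betw ((*) x) ?A ?A"
    by (rule bij_betwI[of _ _ _ "\<lambda>y. y / x"]) (use False in auto)
  then have "\<Prod>?A = (\<Prod>y\<in>?A. x * y)"
    by (rule prod.reindex_bij_betw[symmetric])
  also have "\<dots> = x ^ card ?A * \<Prod>?A"
    by (simp add: prod.distrib)
  finally have "x ^ card ?A = 1"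
    by simp
  moreover have "CARD('a) = Suc (card ?A)"
    by (simp add: card_Diff_singleton card_gt_0_iff)
  ultimately show ?thesis
    by (simp only: power_Suc mult_1_right)
qed

lemma power_CARD_power_eq_self:
  fixes x :: "'a::{field,finite}"
  shows "x ^ (CARD('a) ^ m) = x"
  by (induction m) (simp_all add: power_mult power_CARD_eq_self)

lemma poly_eq_0_if_many_roots:
  fixes p :: "'a::{idom} poly"
  assumes "finite A" "\<And>x. x \<in> A \<Longrightarrow> poly p x = 0" "degree p < card A"
  shows "p = 0"
proof (rule ccontr)
  assume "p \<noteq> 0"
  then have "card A \<le> card {x. poly p x = 0}"
    using assms(2) by (intro card_mono poly_roots_finite) auto
  also have "\<dots> \<le> degree p"
    using \<open>p \<noteq> 0\<close> by (rule card_poly_roots_bound)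
  finally show False
    using assms(3) by simp
qed

context
  fixes \<iota> :: "'k::{field,finite} \<Rightarrow> 'a::{field,finite}" and q :: nat
  assumes emb: "field_embedding \<iota>" and q: "CARD('k) = q"
begin

lemma card_range_embedding: "card (range \<iota>) = q"
  using field_embedding_inj[OF emb] q by (simp add: card_image)

lemma CARD_base_gt_1: "q > 1"
proof -
  have "card {0, 1::'k} \<le> CARD('k)"
    by (rule card_mono) simp_all
  then show ?thesis
    using q by simp
qed

lemma range_embedding_power: "z \<in> range \<iota> \<Longrightarrow> z ^ q = z"
  using power_CARD_eq_self[where ?'a = 'k] q field_embedding_simps(6)[OF emb, of _ q]
  by (metis rangeE)

text \<open>The polynomial \<open>X^q - X\<close> has at most \<open>q\<close> roots, and the
  \<open>q\<close> elements of the embedded base field already are roots.\<close>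

lemma range_embedding_eq: "range \<iota> = {x. x ^ q = x}"
proof
  show "range \<iota> \<subseteq> {x. x ^ q = x}"
    using range_embedding_power by blast
  show "{x. x ^ q = x} \<subseteq> range \<iota>"
  proof (rule card_subset_eq[THEN equalityD2])
    let ?p = "monom 1 q - monom 1 1 :: 'a poly"
    have deg: "degree ?p \<le> q"
      using CARD_base_gt_1
      by (intro degree_diff_le) (rule order.trans[OF degree_monom_le], simp)+
    have "coeff ?p q = 1"
      using CARD_base_gt_1 by simp
    then have "?p \<noteq> 0"
      by (metis coeff_0 zero_neq_one)
    then have "card {x. poly ?p x = 0} \<le> q"
      using card_poly_roots_bound[of ?p] deg by simp
    then have "card {x::'a. x ^ q = x} \<le> q"
      by (simp add: poly_monom)
    moreover have "card (range \<iota>) \<le> card {x::'a. x ^ q = x}"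
      using range_embedding_power by (intro card_mono) auto
    ultimately show "card (range \<iota>) = card {x::'a. x ^ q = x}"
      using card_range_embedding by simp
  qed (use range_embedding_power in auto)
qed

text \<open>
  Since \<open>z\<^sup>q = z\<close> on \<open>F\<^sub>q\<close>, the polynomial \<open>(X + 1)\<^sup>q - X\<^sup>q - 1\<close> of degree less than \<open>q\<close> has \<open>q\<close> roots,
  so its coefficients vanish. This avoids showing first that \<open>q\<close> is a power of the characteristic.
\<close>

lemma binomial_CARD_eq_0:
  assumes "0 < i" "i < q"
  shows "of_nat (q choose i) = (0::'a)"
proof -
  let ?p = "\<Sum>i\<in>{1..<q}. monom (of_nat (q choose i)) i :: 'a poly"
  have "?p = 0"
  proof (rule poly_eq_0_if_many_roots[of "range \<iota>"])
    fix z assume z: "z \<in> range \<iota>"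
    have "{..q} = insert 0 (insert q {1..<q})"
      using CARD_base_gt_1 by auto
    then have "(z + 1) ^ q = 1 + (z ^ q + poly ?p z)"
      using CARD_base_gt_1 by (simp add: binomial_ring poly_sum poly_monom)
    moreover obtain c where "z = \<iota> c"
      using z by blast
    then have "z + 1 = \<iota> (c + 1)"
      by (simp add: field_embedding_simps[OF emb])
    then have "z + 1 \<in> range \<iota>"
      by simp
    ultimately show "poly ?p z = 0"
      using range_embedding_power[OF z] range_embedding_power[of "z + 1"] by simp
  next
    have "degree (monom (of_nat (q choose i)) i :: 'a poly) \<le> q - 1" if "i \<in> {1..<q}" for i
      by (rule order.trans[OF degree_monom_le]) (use that in auto)
    then have "degree ?p \<le> q - 1"
      by (intro degree_sum_le) simp_all
    then show "degree ?p < card (range \<iota>)"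
      using CARD_base_gt_1 card_range_embedding by simp
  qed simp
  then have "coeff ?p i = 0"
    by simp
  then show ?thesis
    using assms by (simp add: coeff_sum)
qed

lemma power_CARD_add: "(x + y :: 'a) ^ q = x ^ q + y ^ q"
proof -
  have "{..q} = insert 0 (insert q {1..<q})"
    using CARD_base_gt_1 by auto
  then have "(x + y) ^ q = y ^ q + (x ^ q + (\<Sum>i\<in>{1..<q}. of_nat (q choose i) * x ^ i * y ^ (q - i)))"
    using CARD_base_gt_1 by (simp add: binomial_ring)
  also have "(\<Sum>i\<in>{1..<q}. of_nat (q choose i) * x ^ i * y ^ (q - i)) = 0"
    by (intro sum.neutral) (simp add: binomial_CARD_eq_0)
  finally show ?thesis
    by simp
qed

lemma power_CARD_power_add: "(x + y :: 'a) ^ (q ^ m) = x ^ (q ^ m) + y ^ (q ^ m)"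
  by (induction m) (simp_all add: power_mult power_CARD_add mult.commute[of q])

end

section \<open>Frobenius powers, the norm and squares in the extension\<close>

context
  fixes \<iota> :: "'k::{field,finite} \<Rightarrow> 'a::{field,finite}" and q n :: nat
  assumes emb: "field_embedding \<iota>" and q: "CARD('k) = q" and qn: "CARD('a) = q ^ n" and n: "n > 0"
begin

lemma power_base_power_eq_self: "(x::'a) ^ (q ^ (n * m)) = x"
  using power_CARD_power_eq_self[of x m] by (simp add: qn power_mult)

text \<open>Reduces integer exponents to natural ones: for \<open>r = - m\<close>, the identities
  \<open>m * (n - 1) + m = n * m\<close> and \<open>x^(q^n) = x\<close> identify the inverse of
  \<open>x^(q^m)\<close>, and \<open>n - 1\<close> is coprime to \<open>n\<close>.\<close>

lemma frob_eq_power: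
  assumes "gcd (int n) r = 1"
  obtains k where "frob q r = (\<lambda>x::'a. x ^ (q ^ k))" "coprime n k"
proof (cases "r \<ge> 0")
  case True
  show ?thesis
  proof (rule that[of "nat r"])
    show "frob q r = (\<lambda>x::'a. x ^ (q ^ nat r))"
      using True by (simp add: frob_def fun_eq_iff)
    have "coprime (int n) (int (nat r))"
      using True assms by (simp add: coprime_iff_gcd_eq_1)
    then show "coprime n (nat r)"
      by (simp only: coprime_int_iff)
  qed
next
  case False
  define m where "m = nat (- r)"
  have m: "r = - int m"
    using False by (simp add: m_def)
  have exp: "m * (n - 1) + m = n * m"
    using n by (cases n) (simp_all add: algebra_simps)
  have eq: "q ^ (m * (n - 1)) * q ^ m = q ^ (n * m)" "q ^ m * q ^ (m * (n - 1)) = q ^ (n * m)"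
    unfolding power_add[symmetric] by (simp_all only: exp add.commute[of m])
  have "inv (\<lambda>y::'a. y ^ (q ^ m)) = (\<lambda>x. x ^ (q ^ (m * (n - 1))))"
    by (intro inv_equality)
      (simp_all only: power_base_power_eq_self eq flip: power_mult)
  moreover have "frob q r x = inv (\<lambda>y::'a. y ^ (q ^ m)) x" for x
    using False by (simp only: frob_def m_def if_False)
  ultimately have "frob q r = (\<lambda>x::'a. x ^ (q ^ (m * (n - 1))))"
    by (simp only: fun_eq_iff) simp
  moreover have "coprime n (m * (n - 1))"
  proof -
    have "coprime (int n) (int m)"
      using assms by (simp add: m coprime_iff_gcd_eq_1)
    then have "coprime n m"
      by (simp only: coprime_int_iff)
    moreover have "coprime n (n - 1)"
      using coprime_diff_one_right_nat[OF n] by (simp add: coprime_commute)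
    ultimately show ?thesis
      by simp
  qed
  ultimately show ?thesis
    by (rule that)
qed

text \<open>With \<open>k * u = n * v + 1\<close> from Bezout, the \<open>u\<close>-fold iterate of
  the power map sends \<open>x\<close> to \<open>x ^ q\<close>, so fixed elements are roots of
  \<open>X^q - X\<close>.\<close>

lemma power_fixed_iff_range_embedding:
  assumes "coprime n k"
  shows "(x::'a) ^ (q ^ k) = x \<longleftrightarrow> x \<in> range \<iota>"
proof
  assume fixed: "x ^ (q ^ k) = x"
  have iter: "x ^ (q ^ (k * m)) = x" for m
    by (induction m) (simp_all add: power_add power_mult fixed)
  have "x ^ q = x"
  \<comment> \<open>This form of Bezout requires \<open>k\<close> nonzero; for \<open>k = 0\<close>
    coprimality forces \<open>n = 1\<close>, where \<open>x ^ q = x\<close> holds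
    throughout.\<close>
  proof (cases "k = 0")
    case True
    then have "n = 1"
      using assms by simp
    then show ?thesis
      using power_base_power_eq_self[of x 1] by simp
  next
    case False
    then obtain u v where uv: "k * u = n * v + 1"
      using bezout_nat[of k n] assms by (auto simp: coprime_iff_gcd_eq_1 gcd.commute)
    have "x ^ (q ^ (k * u)) = (x ^ (q ^ (n * v))) ^ q"
      by (simp add: uv mult.commute flip: power_mult)
    then show ?thesis
      by (simp add: iter power_base_power_eq_self)
  qed
  then show "x \<in> range \<iota>"
    by (simp add: range_embedding_eq[OF emb q])
next
  assume "x \<in> range \<iota>"
  then have "x ^ q = x"
    by (rule range_embedding_power[OF emb q])
  then show "x ^ (q ^ k) = x"
    by (induction k) (simp_all add: power_mult)
qed

lemma field_norm_mult: "field_norm q n (x * y) = field_norm q n x * field_norm q n (y::'a)"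
  by (simp add: field_norm_def power_mult_distrib prod.distrib)

text \<open>Multiplying by \<open>x\<close> turns the norm of \<open>x ^ q\<close> into the product
  of all \<open>x^(q^i)\<close> with \<open>i \<le> n\<close>, whose last factor
  \<open>x^(q^n)\<close> is \<open>x\<close> again.\<close>

lemma field_norm_power_base: "field_norm q n (x ^ q) = field_norm q n (x::'a)"
proof -
  have "x * field_norm q n (x ^ q) = (\<Prod>i<Suc n. x ^ (q ^ i))"
    by (simp add: field_norm_def prod.lessThan_Suc_shift del: prod.lessThan_Suc flip: power_mult)
  also have "\<dots> = x * field_norm q n x"
    using power_base_power_eq_self[of x 1] by (simp add: field_norm_def)
  finally show ?thesis
    by (cases "x = 0") (use CARD_base_gt_1[OF emb q] in \<open>auto simp: power_0_left\<close>)
qed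

lemma field_norm_power_base_power: "field_norm q n (x ^ (q ^ k)) = field_norm q n (x::'a)"
  by (induction k) (simp_all add: power_mult field_norm_power_base mult.commute[of q])

lemma field_norm_nonzero: "x \<noteq> 0 \<Longrightarrow> field_norm q n (x::'a) \<noteq> 0"
  by (simp add: field_norm_def)

text \<open>A nonzero difference \<open>z\<close> of two elements with the same image would satisfy
  \<open>z = b * z^(q^k)\<close>, and taking norms would give \<open>b\<close> norm 1.\<close>

lemma bij_diff_mult_power:
  fixes b :: 'a
  assumes "field_norm q n b \<noteq> 1"
  shows "bij (\<lambda>x. x - b * x ^ (q ^ k))"
proof -
  have "inj (\<lambda>x. x - b * x ^ (q ^ k))"
  proof (rule injI)
    fix x y assume "x - b * x ^ (q ^ k) = y - b * y ^ (q ^ k)"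
    moreover have "x ^ (q ^ k) = (x - y) ^ (q ^ k) + y ^ (q ^ k)"
      using power_CARD_power_add[OF emb q, of "x - y" y k] by simp
    ultimately have "x - y = b * (x - y) ^ (q ^ k)"
      by (simp add: algebra_simps)
    then have "field_norm q n (x - y) = field_norm q n b * field_norm q n (x - y)"
      by (metis field_norm_mult field_norm_power_base_power)
    then show "x = y"
      using assms field_norm_nonzero[of "x - y"] by auto
  qed
  then show ?thesis
    by (simp add: bij_def finite_UNIV_inj_surj)
qed

text \<open>A square root \<open>z\<close> satisfies \<open>z ^ q = z\<close> or
  \<open>z ^ q = - z\<close>. The first puts \<open>z\<close> into the base field; the second yields
  \<open>z = z^(q^n) = - z\<close> because \<open>n\<close> is odd, so \<open>z = 0\<close>, and 0
  is a square.\<close>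

lemma embedding_nonsquare:
  assumes "odd n" "(2::'a) \<noteq> 0" "\<not> (\<exists>z. \<xi> = z ^ 2)"
  shows "\<iota> \<xi> \<noteq> z ^ 2"
proof
  assume z: "\<iota> \<xi> = z ^ 2"
  have "(z ^ q) ^ 2 = z ^ 2"
    using range_embedding_power[OF emb q rangeI[of \<iota> \<xi>]]
    by (simp add: z mult.commute flip: power_mult)
  then consider "z ^ q = z" | "z ^ q = - z"
    by (auto simp: power2_eq_iff)
  then show False
  proof cases
    case 1
    then obtain c where "z = \<iota> c"
      using range_embedding_eq[OF emb q] by blast
    then have "\<iota> \<xi> = \<iota> (c ^ 2)"
      using z by (simp add: field_embedding_simps[OF emb])
    then show False
      using assms(3) injD[OF field_embedding_inj[OF emb]] by blast
  next
    case 2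
    have minus: "(- y) ^ q = - (y ^ q)" for y :: 'a
      using power_CARD_add[OF emb q, of y "- y"] CARD_base_gt_1[OF emb q]
      by (simp add: power_0_left add_eq_0_iff)
    have "z ^ (q ^ m) = (- 1) ^ m * z" for m
    proof (induction m)
      case (Suc m)
      have "z ^ (q ^ Suc m) = ((-1) ^ m * z) ^ q"
        using Suc by (simp add: mult.commute[of q] power_mult)
      then show ?case
        using 2 minus[of z] by (cases "even m") auto
    qed simp
    from this[of n] have "z = - z"
      using power_base_power_eq_self[of z 1] assms(1) by simp
    then have "2 * z = 0"
      by (metis add.right_inverse mult_2)
    then have "\<iota> \<xi> = \<iota> (0 ^ 2)"
      using z assms(2) by (simp add: field_embedding_simps[OF emb])
    then show False
      using assms(3) injD[OF field_embedding_inj[OF emb]] by blast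
  qed
qed

text \<open>\<open>binomial_CARD_eq_0\<close> at index 1 says that \<open>q\<close> vanishes in the
  field, whereas \<open>2 = 0\<close> would make the odd number \<open>q\<close> equal to 1.\<close>

lemma two_neq_zero:
  assumes "odd q"
  shows "(2::'a) \<noteq> 0"
proof
  assume two: "(2::'a) = 0"
  obtain m where "q = 2 * m + 1"
    using assms by (elim oddE)
  then have "of_nat q = (1::'a)"
    by (simp add: two)
  then show False
    using binomial_CARD_eq_0[OF emb q, of 1] CARD_base_gt_1[OF emb q] by simp
qed

end

subsection \<open>Lines and weights\<close>

text \<open>The explicit coefficient form lets independence be decided by simplification in frame
  coordinates.\<close>

definition indep2 :: "'a::field^4 \<Rightarrow> 'a^4 \<Rightarrow> bool" where
  "indep2 u v \<longleftrightarrow> (\<forall>\<alpha> \<beta>. \<alpha> *s u + \<beta> *s v = 0 \<longrightarrow> \<alpha> = 0 \<and> \<beta> = 0)"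

lemma indep2_imp_independent:
  assumes "indep2 u v"
  shows "u \<noteq> v" "vec.independent {u, v}"
proof -
  have zero: "\<alpha> *s u + \<beta> *s v = 0 \<Longrightarrow> \<alpha> = 0 \<and> \<beta> = 0" for \<alpha> \<beta>
    using assms unfolding indep2_def by blast
  show "u \<noteq> v"
    using zero[of 1 "-1"] by auto
  have "v \<noteq> 0"
    using zero[of 0 1] by auto
  moreover have "u \<notin> vec.span {v}"
  proof
    assume "u \<in> vec.span {v}"
    then obtain k where "u = k *s v"
      by (auto simp: vec.span_singleton)
    then show False
      using zero[of 1 "- k"] by simp
  qed
  ultimately show "vec.independent {u, v}"
    by (simp add: vec.independent_insert)
qed

lemma span2_eq: "vec.span {u, v} = {\<alpha> *s u + \<beta> *s v |\<alpha> \<beta>. True}" for u v :: "'a::field^4"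
proof (rule set_eqI)
  fix x
  have "x \<in> vec.span {u, v} \<longleftrightarrow> (\<exists>\<alpha> \<beta>. x - \<alpha> *s u = \<beta> *s v)"
    unfolding vec.span_insert[of u "{v}"] vec.span_singleton by blast
  also have "\<dots> \<longleftrightarrow> (\<exists>\<alpha> \<beta>. x = \<alpha> *s u + \<beta> *s v)"
    by (simp add: diff_eq_eq add.commute)
  finally show "x \<in> vec.span {u, v} \<longleftrightarrow> x \<in> {\<alpha> *s u + \<beta> *s v |\<alpha> \<beta>. True}"
    by simp
qed

lemma is_line_span2:
  assumes "indep2 u v"
  shows "is_line (vec.span {u, v})"
  using vec.dim_span_eq_card_independent[OF indep2_imp_independent(2)[OF assms]]
    indep2_imp_independent(1)[OF assms]
  by (simp add: is_line_def)

lemma is_line_eq_span2: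
  assumes "is_line T" "u \<in> T" "v \<in> T" "indep2 u v"
  shows "T = vec.span {u, v}"
proof
  have "vec.subspace T" "vec.dim T = 2"
    using assms(1) by (simp_all add: is_line_def)
  then show "T \<subseteq> vec.span {u, v}"
    using assms(2,3) indep2_imp_independent[OF assms(4)]
    by (intro vec.card_ge_dim_independent) auto
  show "vec.span {u, v} \<subseteq> T"
    using assms(2,3) \<open>vec.subspace T\<close> by (intro vec.span_minimal) auto
qed

lemma is_line_unique:
  assumes "is_line S" "is_line T" "u \<in> S" "v \<in> S" "u \<in> T" "v \<in> T" "indep2 u v"
  shows "S = T"
  using assms is_line_eq_span2 by metis

text \<open>Equal spans put the generator \<open>u\<close> into the subspace \<open>T\<close>. The
  set \<open>A\<close> is kept arbitrary so that it can be an F_q-subspace or the zero set of a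
  quadratic form.\<close>

lemma disjnt_linear_set_iff:
  assumes "vec.subspace T"
  shows "disjnt (linear_set T) (linear_set A) \<longleftrightarrow> T \<inter> A \<subseteq> {0}"
proof
  assume "disjnt (linear_set T) (linear_set A)"
  then show "T \<inter> A \<subseteq> {0}"
    unfolding disjnt_iff linear_set_def by blast
next
  assume disj: "T \<inter> A \<subseteq> {0}"
  have False if "t \<in> T" "u \<in> A" "u \<noteq> 0" "vec.span {t} = vec.span {u}" for t u
  proof -
    have "u \<in> vec.span {t}"
      using that(4) vec.span_base by blast
    moreover have "vec.span {t} \<subseteq> T"
      using that(1) assms by (intro vec.span_minimal) auto
    ultimately show False
      using disj that by blast
  qed
  then show "disjnt (linear_set T) (linear_set A)"
    unfolding disjnt_iff linear_set_def by blast
qed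

section \<open>Dimensions over the base field by counting\<close>

lemma card_span_independent:
  fixes scale :: "'k::{field,finite} \<Rightarrow> 'b::ab_group_add \<Rightarrow> 'b"
  assumes "vector_space scale" "finite B" "\<not> module.dependent scale B"
  shows "card (module.span scale B) = CARD('k) ^ card B"
proof -
  interpret vector_space scale
    by fact
  show ?thesis
    using assms(2,3)
  proof (induction B rule: finite_induct)
    case empty
    then show ?case by simp
  next
    case (insert a B)
    then have a: "a \<notin> span B" and B: "independent B"
      by (simp_all add: independent_insert)
    let ?f = "\<lambda>(k, x). scale k a + x"
    have "inj_on ?f (UNIV \<times> span B)"
    proof (rule inj_onI, clarify)
      fix k l x y
      assume xy: "x \<in> span B" "y \<in> span B" and eq: "scale k a + x = scale l a + y"
      have "scale (k - l) a = y - x"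
        using eq by (simp add: scale_left_diff_distrib algebra_simps)
      then have "scale (k - l) a \<in> span B"
        using xy by (simp add: span_diff)
      \<comment> \<open>For distinct \<open>k\<close> and \<open>l\<close> the scalar is 1, which
        would place \<open>a\<close> in the span of \<open>B\<close>.\<close>
      then have "scale (inverse (k - l) * (k - l)) a \<in> span B"
        using span_scale by fastforce
      then have "k = l"
        using a by (cases "k = l") simp_all
      then show "k = l \<and> x = y"
        using eq by simp
    qed
    moreover have "span (insert a B) = ?f ` (UNIV \<times> span B)"
    proof
      show "span (insert a B) \<subseteq> ?f ` (UNIV \<times> span B)"
      proof
        fix x assume "x \<in> span (insert a B)"
        then obtain k where "x - scale k a \<in> span B"
          by (auto simp: span_insert)
        then have "?f (k, x - scale k a) \<in> ?f ` (UNIV \<times> span B)"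
          by blast
        then show "x \<in> ?f ` (UNIV \<times> span B)"
          by simp
      qed
      show "?f ` (UNIV \<times> span B) \<subseteq> span (insert a B)"
      proof clarify
        fix k x assume "x \<in> span B"
        then have "scale k a + x - scale k a \<in> span B"
          by simp
        then show "scale k a + x \<in> span (insert a B)"
          unfolding span_insert by blast
      qed
    qed
    ultimately have "card (span (insert a B)) = CARD('k) * card (span B)"
      by (simp add: card_image card_cartesian_product)
    then show ?case
      using insert B by simp
  qed
qed

lemma card_subspace_eq_power_dim:
  fixes scale :: "'k::{field,finite} \<Rightarrow> 'b::ab_group_add \<Rightarrow> 'b"
  assumes "vector_space scale" "finite S" "module.subspace scale S"
  shows "card S = CARD('k) ^ vector_space.dim scale S"
proof -
  interpret vector_space scale
    by fact
  obtain B where B: "B \<subseteq> S" "independent B" "S \<subseteq> span B" "card B = dim S"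
    using basis_exists by blast
  then have "span B = S"
    using assms(3) span_minimal[of B S] by blast
  moreover have "finite B"
    using B(1) assms(2) finite_subset by blast
  ultimately show ?thesis
    using card_span_independent[OF assms(1) _ B(2)] B(4) by simp
qed

lemma vector_space_base_scale:
  assumes "field_embedding \<iota>"
  shows "vector_space (base_scale \<iota>)"
  by unfold_locales
    (simp_all add: base_scale_def field_embedding_simps[OF assms] vec.scale_right_distrib
      vec.scale_left_distrib)

lemma subspace_base_scale_iff:
  assumes "field_embedding \<iota>"
  shows "module.subspace (base_scale \<iota>) A \<longleftrightarrow>
    0 \<in> A \<and> (\<forall>x\<in>A. \<forall>y\<in>A. x + y \<in> A) \<and> (\<forall>c. \<forall>x\<in>A. \<iota> c *s x \<in> A)"
  using module.subspace_def[of "base_scale \<iota>"] vector_space_base_scale[OF assms]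
  by (simp add: module_iff_vector_space base_scale_def)

text \<open>The base field has more than one element, so the cardinality determines the exponent;
  ranks and weights are computed this way below.\<close>

lemma dim_base_scale_eq_iff:
  fixes \<iota> :: "'k::{field,finite} \<Rightarrow> 'a::{field,finite}" and A :: "('a^4) set"
  assumes "field_embedding \<iota>" "module.subspace (base_scale \<iota>) A"
  shows "vector_space.dim (base_scale \<iota>) A = m \<longleftrightarrow> card A = CARD('k) ^ m"
proof -
  have "card A = CARD('k) ^ vector_space.dim (base_scale \<iota>) A"
    using vector_space_base_scale assms by (intro card_subspace_eq_power_dim) auto
  then show ?thesis
    using CARD_base_gt_1[OF assms(1) refl] by simp
qed

lemma weight_eq_iff:
  fixes \<iota> :: "'k::{field,finite} \<Rightarrow> 'a::{field,finite}"
  assumes "field_embedding \<iota>" "module.subspace (base_scale \<iota>) U" "vec.subspace W"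
  shows "weight \<iota> U W = m \<longleftrightarrow> card (W \<inter> U) = CARD('k) ^ m"
  unfolding weight_def using assms
  by (intro dim_base_scale_eq_iff) (simp_all add: subspace_base_scale_iff vec.subspace_def)

subsection \<open>A frame adapted to two skew lines\<close>

text \<open>Here \<open>(x, y)\<close> are coordinates along the line of vectors
  \<open>(u, v, v, d u)\<close> and \<open>(z, w)\<close> along that of
  \<open>(- u, - v, v, d u)\<close>.\<close>

definition frame :: "'a::field \<Rightarrow> 'a \<Rightarrow> 'a \<Rightarrow> 'a \<Rightarrow> 'a \<Rightarrow> 'a^4" where
  "frame d x y z w = vector [x - z, y - w, y + w, d * (x + z)]"

lemma vec_4_eq_iff:
  "(u::'a^4) = v \<longleftrightarrow> u $ 1 = v $ 1 \<and> u $ 2 = v $ 2 \<and> u $ 3 = v $ 3 \<and> u $ 4 = v $ 4"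
proof -
  have "(\<forall>i::4. u $ i = v $ i) \<longleftrightarrow> u $ 1 = v $ 1 \<and> u $ 2 = v $ 2 \<and> u $ 3 = v $ 3 \<and> u $ 4 = v $ 4"
    using exhaust_4 by metis
  then show ?thesis
    by (simp add: vec_eq_iff)
qed

lemma frame_nth:
  "frame d x y z w $ 1 = x - z" "frame d x y z w $ 2 = y - w"
  "frame d x y z w $ 3 = y + w" "frame d x y z w $ 4 = d * (x + z)"
  by (simp_all add: frame_def vector_4_nth)

lemma frame_add: "frame d x y z w + frame d x' y' z' w' = frame d (x + x') (y + y') (z + z') (w + w')"
  by (simp add: vec_4_eq_iff frame_nth algebra_simps)

lemma frame_diff: "frame d x y z w - frame d x' y' z' w' = frame d (x - x') (y - y') (z - z') (w - w')"
  by (simp add: vec_4_eq_iff frame_nth algebra_simps)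

lemma frame_scale: "c *s frame d x y z w = frame d (c * x) (c * y) (c * z) (c * w)"
  by (simp add: vec_4_eq_iff frame_nth algebra_simps)

lemma frame_0: "frame d 0 0 0 0 = 0"
  by (simp add: vec_4_eq_iff frame_nth)

text \<open>The absence of mixed products shows that the two skew lines are orthogonal.\<close>

lemma polar_form_frame:
  "polar_form (frame d x y z w) (frame d x' y' z' w') = 2 * d * (x * x' - z * z') - 2 * (y * y' - w * w')"
  by (simp add: polar_form_def quadratic_form_def frame_add frame_nth algebra_simps)

lemma quadratic_form_frame:
  "quadratic_form (frame d x y z w) = d * (x ^ 2 - z ^ 2) - (y ^ 2 - w ^ 2)"
  by (simp add: quadratic_form_def frame_nth algebra_simps power2_eq_square)

section \<open>The graph of a semilinear map and its scatteredness\<close>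

text \<open>Of the power map only the facts that it is a field automorphism and has fixed field F_q
  are kept. The scalar \<open>d\<close> stands for \<open>\<iota> \<xi>\<close>.\<close>

locale semilinear_frame =
  fixes \<iota> :: "'k::{field,finite} \<Rightarrow> 'a::{field,finite}" and n :: nat
    and \<sigma> :: "'a \<Rightarrow> 'a" and b d :: 'a
  assumes emb: "field_embedding \<iota>" and CARD_ext: "CARD('a) = CARD('k) ^ n" and n: "n \<ge> 3"
    and two: "(2::'a) \<noteq> 0" and b: "b \<noteq> 0" and d: "d \<noteq> 0"
    and \<sigma>_add: "\<sigma> (x + y) = \<sigma> x + \<sigma> y" and \<sigma>_mult: "\<sigma> (x * y) = \<sigma> x * \<sigma> y"
    and \<sigma>_bij: "bij \<sigma>" and \<sigma>_fixed: "\<sigma> x = x \<longleftrightarrow> x \<in> range \<iota>"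
begin

lemma \<sigma>_0: "\<sigma> 0 = 0"
  using \<sigma>_fixed[of 0] field_embedding_simps(1)[OF emb] by (metis rangeI)

lemma \<sigma>_1: "\<sigma> 1 = 1"
  using \<sigma>_fixed[of 1] field_embedding_simps(2)[OF emb] by (metis rangeI)

lemma \<sigma>_eq_0_iff: "\<sigma> x = 0 \<longleftrightarrow> x = 0"
  using bij_is_inj[OF \<sigma>_bij] \<sigma>_0 by (metis injD)

lemma \<sigma>_surj: obtains x where "y = \<sigma> x"
  using bij_is_surj[OF \<sigma>_bij] by (metis surjD)

lemma \<sigma>_embedding: "\<sigma> (\<iota> c) = \<iota> c"
  using \<sigma>_fixed by blast

abbreviation fr :: "'a \<Rightarrow> 'a \<Rightarrow> 'a \<Rightarrow> 'a \<Rightarrow> 'a^4" where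
  "fr \<equiv> frame d"

lemma fr_eq_iff: "fr x y z w = fr x' y' z' w' \<longleftrightarrow> x = x' \<and> y = y' \<and> z = z' \<and> w = w'"
proof
  assume eq: "fr x y z w = fr x' y' z' w'"
  then have "x - z = x' - z'" "x + z = x' + z'" "y - w = y' - w'" "y + w = y' + w'"
    using d by (simp_all add: vec_4_eq_iff frame_nth)
  moreover from this have "2 * x = 2 * x'" "2 * y = 2 * y'"
    by algebra+
  ultimately show "x = x' \<and> y = y' \<and> z = z' \<and> w = w'"
    using two by simp
qed simp

lemma fr_eq_0_iff: "fr x y z w = 0 \<longleftrightarrow> x = 0 \<and> y = 0 \<and> z = 0 \<and> w = 0"
  using fr_eq_iff[of x y z w 0 0 0 0] by (simp add: frame_0)

lemma fr_surj: obtains x y z w where "v = fr x y z w"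
proof
  have "(4::'a) = 2 * 2"
    by simp
  then have four: "(4::'a) \<noteq> 0"
    using two by (metis mult_eq_0_iff)
  \<comment> \<open>Half sums and half differences invert the frame: components 1 and 4 determine
    \<open>x\<close> and \<open>z\<close>, components 2 and 3 determine \<open>y\<close> and
    \<open>w\<close>.\<close>
  show "v = fr ((v $ 1 + v $ 4 / d) / 2) ((v $ 2 + v $ 3) / 2) ((v $ 4 / d - v $ 1) / 2) ((v $ 3 - v $ 2) / 2)"
    using two four d by (simp add: vec_4_eq_iff frame_nth field_simps)
qed

definition graph :: "'a \<Rightarrow> 'a \<Rightarrow> 'a^4" where
  "graph x y = fr x y (b * \<sigma> x) (b * \<sigma> y)"

definition U :: "('a^4) set" where
  "U = {graph x y |x y. True}"

definition axis1 :: "('a^4) set" where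
  "axis1 = {fr x y 0 0 |x y. True}"

definition axis2 :: "('a^4) set" where
  "axis2 = {fr 0 0 z w |z w. True}"

definition tline :: "'a \<Rightarrow> 'a \<Rightarrow> ('a^4) set" where
  "tline x y = {fr (\<alpha> * x) (\<alpha> * y) (\<beta> * \<sigma> x) (\<beta> * \<sigma> y) |\<alpha> \<beta>. True}"

lemma graph_in_U [simp]: "graph x y \<in> U"
  by (auto simp: U_def)

lemma U_cases:
  assumes "v \<in> U"
  obtains x y where "v = graph x y"
  using assms by (auto simp: U_def)

lemma graph_eq_iff: "graph x y = graph x' y' \<longleftrightarrow> x = x' \<and> y = y'"
  by (auto simp: graph_def fr_eq_iff)

lemma graph_eq_0_iff: "graph x y = 0 \<longleftrightarrow> x = 0 \<and> y = 0"
  by (auto simp: graph_def fr_eq_0_iff \<sigma>_0)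

lemma graph_add: "graph x y + graph x' y' = graph (x + x') (y + y')"
  by (simp add: graph_def frame_add \<sigma>_add algebra_simps)

lemma graph_scale: "\<iota> c *s graph x y = graph (\<iota> c * x) (\<iota> c * y)"
  by (simp add: graph_def frame_scale \<sigma>_mult \<sigma>_embedding algebra_simps)

lemma subspace_U: "module.subspace (base_scale \<iota>) U"
  unfolding subspace_base_scale_iff[OF emb]
proof (intro conjI ballI allI)
  show "0 \<in> U"
    using graph_eq_0_iff[of 0 0] graph_in_U[of 0 0] by simp
qed (auto simp: graph_add graph_scale elim!: U_cases)

lemma card_U: "card U = CARD('k) ^ (2 * n)"
proof -
  have "U = (\<lambda>(x, y). graph x y) ` (UNIV \<times> UNIV)"
    by (auto simp: U_def)
  moreover have "inj_on (\<lambda>(x, y). graph x y) (UNIV \<times> UNIV)"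
    by (auto simp: inj_on_def graph_eq_iff)
  ultimately show ?thesis
    using CARD_ext by (simp add: card_image card_cartesian_product power_mult power2_eq_square
        flip: power_add mult_2)
qed

text \<open>The first two frame coordinates force the multiple to be
  \<open>graph (c * x) (c * y)\<close>; the last two then compare \<open>c\<close> with
  \<open>\<sigma> c\<close>. This is the scatteredness of \<open>U\<close>.\<close>

lemma scale_graph_in_U_iff:
  assumes "graph x y \<noteq> 0"
  shows "c *s graph x y \<in> U \<longleftrightarrow> c \<in> range \<iota>"
proof
  assume "c *s graph x y \<in> U"
  then obtain x' y' where "c *s graph x y = graph x' y'"
    by (auto simp: U_def)
  then have "c * (b * \<sigma> x) = b * \<sigma> (c * x)" "c * (b * \<sigma> y) = b * \<sigma> (c * y)"
    by (auto simp: graph_def frame_scale fr_eq_iff)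
  then have "(c - \<sigma> c) * \<sigma> x = 0" "(c - \<sigma> c) * \<sigma> y = 0"
    using b by (auto simp: \<sigma>_mult algebra_simps)
  then have "\<sigma> c = c"
    using assms by (auto simp: graph_eq_0_iff \<sigma>_eq_0_iff)
  then show "c \<in> range \<iota>"
    using \<sigma>_fixed by simp
next
  assume "c \<in> range \<iota>"
  then show "c *s graph x y \<in> U"
    by (auto simp: graph_scale)
qed

lemma maximum_scattered_U: "maximum_scattered \<iota> n U"
  unfolding maximum_scattered_def
proof (intro conjI ballI)
  show "module.subspace (base_scale \<iota>) U"
    by (rule subspace_U)
  show "rank_of \<iota> U = 2 * n"
    unfolding rank_of_def using dim_base_scale_eq_iff[OF emb subspace_U] card_U by blast
next
  fix P assume "P \<in> linear_set U"
  then obtain x y where P: "P = vec.span {graph x y}" "graph x y \<noteq> 0"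
    by (auto simp: linear_set_def U_def)
  have "P \<inter> U = (\<lambda>c. \<iota> c *s graph x y) ` UNIV"
    using scale_graph_in_U_iff[OF P(2)] unfolding P(1) vec.span_singleton by auto
  moreover have "inj (\<lambda>c. \<iota> c *s graph x y)"
    using field_embedding_inj[OF emb] P(2) by (simp add: inj_def)
  ultimately have "card (P \<inter> U) = CARD('k) ^ 1"
    by (simp add: card_image)
  then show "weight \<iota> U P = 1"
    using weight_eq_iff[OF emb subspace_U] P(1) vec.subspace_span by blast
qed

section \<open>The two axes and the long lines joining them\<close>

lemma is_line_axis1: "is_line axis1"
proof -
  have "axis1 = vec.span {fr 1 0 0 0, fr 0 1 0 0}"
    by (auto simp: axis1_def span2_eq frame_scale frame_add)
  moreover have "indep2 (fr 1 0 0 0) (fr 0 1 0 0)"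
    by (simp add: indep2_def frame_scale frame_add fr_eq_0_iff)
  ultimately show ?thesis
    using is_line_span2 by simp
qed

lemma is_line_axis2: "is_line axis2"
proof -
  have "axis2 = vec.span {fr 0 0 1 0, fr 0 0 0 1}"
    by (auto simp: axis2_def span2_eq frame_scale frame_add)
  moreover have "indep2 (fr 0 0 1 0) (fr 0 0 0 1)"
    by (simp add: indep2_def frame_scale frame_add fr_eq_0_iff)
  ultimately show ?thesis
    using is_line_span2 by simp
qed

lemma axes_neq: "axis1 \<noteq> axis2"
proof -
  have "fr 1 0 0 0 \<in> axis1" "fr 1 0 0 0 \<notin> axis2"
    by (auto simp: axis1_def axis2_def fr_eq_iff)
  then show ?thesis
    by blast
qed

lemma indep2_tline:
  assumes "(x, y) \<noteq> (0, 0)"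
  shows "indep2 (fr x y 0 0) (fr 0 0 (\<sigma> x) (\<sigma> y))"
  using assms by (auto simp: indep2_def frame_scale frame_add fr_eq_0_iff \<sigma>_eq_0_iff)

lemma tline_eq_span: "tline x y = vec.span {fr x y 0 0, fr 0 0 (\<sigma> x) (\<sigma> y)}"
  by (auto simp: tline_def span2_eq frame_scale frame_add)

lemma is_line_tline: "(x, y) \<noteq> (0, 0) \<Longrightarrow> is_line (tline x y)"
  using is_line_span2[OF indep2_tline] by (simp add: tline_eq_span)

lemma tline_memI: "fr x y 0 0 \<in> tline x y" "fr 0 0 (\<sigma> x) (\<sigma> y) \<in> tline x y"
  by (simp_all add: tline_eq_span vec.span_base)

lemma long_line_tline:
  assumes "(x, y) \<noteq> (0, 0)"
  shows "long_line \<iota> n U (tline x y)"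
proof -
  have "tline x y \<inter> U = range (\<lambda>\<alpha>. graph (\<alpha> * x) (\<alpha> * y))"
  proof
    show "tline x y \<inter> U \<subseteq> range (\<lambda>\<alpha>. graph (\<alpha> * x) (\<alpha> * y))"
      by (auto simp: tline_def U_def graph_def fr_eq_iff)
    have "graph (\<alpha> * x) (\<alpha> * y) \<in> tline x y" for \<alpha>
      unfolding graph_def tline_def mem_Collect_eq
      \<comment> \<open>Semilinearity gives \<open>b * \<sigma> (\<alpha> * x) = (b * \<sigma>
        \<alpha>) * \<sigma> x\<close>, which dictates the second coefficient.\<close>
      by (rule exI[of _ \<alpha>], rule exI[of _ "b * \<sigma> \<alpha>"]) (simp add: \<sigma>_mult ac_simps)
    then show "range (\<lambda>\<alpha>. graph (\<alpha> * x) (\<alpha> * y)) \<subseteq> tline x y \<inter> U"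
      by (auto simp: U_def)
  qed
  moreover have "inj (\<lambda>\<alpha>. graph (\<alpha> * x) (\<alpha> * y))"
    using assms by (auto simp: inj_def graph_eq_iff)
  ultimately have "card (tline x y \<inter> U) = CARD('k) ^ n"
    by (simp add: card_image CARD_ext)
  moreover have "vec.subspace (tline x y)"
    by (simp add: tline_eq_span)
  ultimately show ?thesis
    using is_line_tline[OF assms] weight_eq_iff[OF emb subspace_U]
    by (simp add: long_line_def)
qed

text \<open>
  Three \<open>F\<^sub>q\<close>-independent vectors of \<open>U\<close> on a line are linearly dependent over the big field;
  comparing the two components of the dependency forces the first components of two of them to be
  proportional, so that the line is of the form \<^const>\<open>tline\<close>. This is where \<open>n \<ge> 3\<close> enters.
\<close>

lemma line_eq_tline:
  assumes s: "is_line s" and in_s: "graph x1 y1 \<in> s" "graph x2 y2 \<in> s" "graph x3 y3 \<in> s"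
    and indep1: "graph x1 y1 \<noteq> 0"
    and indep2: "\<And>k. graph x2 y2 \<noteq> \<iota> k *s graph x1 y1"
    and indep3: "\<And>k l. graph x3 y3 \<noteq> \<iota> k *s graph x1 y1 + \<iota> l *s graph x2 y2"
  shows "s = tline x1 y1"
proof -
  have sub: "vec.subspace s"
    using s by (simp add: is_line_def)
  \<comment> \<open>A dependency would make the second vector a multiple of the first, and by
    scatteredness the factor would lie in F_q.\<close>
  have "indep2 (graph x1 y1) (graph x2 y2)"
    unfolding indep2_def
  proof (intro allI impI)
    fix \<alpha> \<beta> assume eq: "\<alpha> *s graph x1 y1 + \<beta> *s graph x2 y2 = 0"
    show "\<alpha> = 0 \<and> \<beta> = 0"
    proof (cases "\<beta> = 0")
      case True
      then show ?thesis
        using eq indep1 by simp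
    next
      case False
      from eq have "\<beta> *s graph x2 y2 = (- \<alpha>) *s graph x1 y1"
        by (simp add: add_eq_0_iff)
      then have "inverse \<beta> *s (\<beta> *s graph x2 y2) = inverse \<beta> *s ((- \<alpha>) *s graph x1 y1)"
        by simp
      then have eq': "graph x2 y2 = (inverse \<beta> * - \<alpha>) *s graph x1 y1"
        using False by simp
      then have "inverse \<beta> * - \<alpha> \<in> range \<iota>"
        using scale_graph_in_U_iff[OF indep1] graph_in_U by metis
      then obtain k where "inverse \<beta> * - \<alpha> = \<iota> k"
        by blast
      then show ?thesis
        using eq' indep2 by metis
    qed
  qed
  then have "s = vec.span {graph x1 y1, graph x2 y2}"
    using is_line_eq_span2 s in_s by blast
  then obtain \<alpha> \<beta> where \<alpha>\<beta>: "graph x3 y3 = \<alpha> *s graph x1 y1 + \<beta> *s graph x2 y2"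
    using in_s(3) by (auto simp: span2_eq)
  then have comps: "x3 = \<alpha> * x1 + \<beta> * x2 \<and> y3 = \<alpha> * y1 + \<beta> * y2 \<and>
      b * \<sigma> x3 = \<alpha> * (b * \<sigma> x1) + \<beta> * (b * \<sigma> x2) \<and> b * \<sigma> y3 = \<alpha> * (b * \<sigma> y1) + \<beta> * (b * \<sigma> y2)"
    unfolding graph_def frame_scale frame_add fr_eq_iff .
  then have "b * \<sigma> (\<alpha> * x1 + \<beta> * x2) = \<alpha> * (b * \<sigma> x1) + \<beta> * (b * \<sigma> x2)"
    "b * \<sigma> (\<alpha> * y1 + \<beta> * y2) = \<alpha> * (b * \<sigma> y1) + \<beta> * (b * \<sigma> y2)"
    by metis+
  then have "b * ((\<sigma> \<beta> - \<beta>) * \<sigma> x2) = b * ((\<alpha> - \<sigma> \<alpha>) * \<sigma> x1)"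
    "b * ((\<sigma> \<beta> - \<beta>) * \<sigma> y2) = b * ((\<alpha> - \<sigma> \<alpha>) * \<sigma> y1)"
    by (simp_all add: \<sigma>_add \<sigma>_mult algebra_simps)
  then have dep: "(\<sigma> \<beta> - \<beta>) * \<sigma> x2 = (\<alpha> - \<sigma> \<alpha>) * \<sigma> x1" "(\<sigma> \<beta> - \<beta>) * \<sigma> y2 = (\<alpha> - \<sigma> \<alpha>) * \<sigma> y1"
    using b by simp_all
  have "\<sigma> \<beta> \<noteq> \<beta>"
  proof
    assume "\<sigma> \<beta> = \<beta>"
    then have "\<sigma> \<alpha> = \<alpha>"
      using dep indep1 by (auto simp: graph_eq_0_iff \<sigma>_eq_0_iff)
    then have "\<alpha> \<in> range \<iota>" "\<beta> \<in> range \<iota>"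
      using \<open>\<sigma> \<beta> = \<beta>\<close> \<sigma>_fixed by simp_all
    then show False
      using \<alpha>\<beta> indep3 by auto
  qed
  \<comment> \<open>Writing the ratio as a value of \<open>\<sigma>\<close> allows the
    proportionality of images to be pulled back to \<open>(x2, y2) = c (x1, y1)\<close>.\<close>
  obtain c where c: "(\<alpha> - \<sigma> \<alpha>) / (\<sigma> \<beta> - \<beta>) = \<sigma> c"
    by (rule \<sigma>_surj)
  have "\<sigma> x2 = (\<alpha> - \<sigma> \<alpha>) / (\<sigma> \<beta> - \<beta>) * \<sigma> x1" "\<sigma> y2 = (\<alpha> - \<sigma> \<alpha>) / (\<sigma> \<beta> - \<beta>) * \<sigma> y1"
    using dep \<open>\<sigma> \<beta> \<noteq> \<beta>\<close> by (simp_all add: field_simps)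
  then have "\<sigma> x2 = \<sigma> (c * x1)" "\<sigma> y2 = \<sigma> (c * y1)"
    by (simp_all only: c \<sigma>_mult)
  then have x2: "x2 = c * x1" "y2 = c * y1"
    using bij_is_inj[OF \<sigma>_bij] by (simp_all add: inj_eq)
  have "\<sigma> c \<noteq> c"
  proof
    assume "\<sigma> c = c"
    then obtain k where "c = \<iota> k"
      using \<sigma>_fixed by blast
    then show False
      using indep2[of k] by (simp add: graph_scale x2)
  qed
  \<comment> \<open>The difference cancels the \<open>axis1\<close> part and leaves a nonzero
    multiple of the point on \<open>axis2\<close>, so \<open>s\<close> contains the feet of the
    \<open>tline\<close> on both axes.\<close>
  have "graph x2 y2 - c *s graph x1 y1 \<in> s"
    using in_s sub by (intro vec.subspace_diff vec.subspace_scale)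
  moreover have "graph x2 y2 - c *s graph x1 y1 = (b * (\<sigma> c - c)) *s fr 0 0 (\<sigma> x1) (\<sigma> y1)"
    by (simp add: graph_def frame_scale frame_diff \<sigma>_mult x2 algebra_simps)
  ultimately have "inverse (b * (\<sigma> c - c)) *s ((b * (\<sigma> c - c)) *s fr 0 0 (\<sigma> x1) (\<sigma> y1)) \<in> s"
    using sub by (metis vec.subspace_scale)
  moreover have "b * (\<sigma> c - c) \<noteq> 0"
    using b \<open>\<sigma> c \<noteq> c\<close> by simp
  then have "inverse (b * (\<sigma> c - c)) * (b * (\<sigma> c - c)) = 1"
    by (rule Fields.field_class.field_inverse)
  ultimately have v2: "fr 0 0 (\<sigma> x1) (\<sigma> y1) \<in> s"
    by (simp only: vec.scale_scale vec.scale_one)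
  have "graph x1 y1 - b *s fr 0 0 (\<sigma> x1) (\<sigma> y1) \<in> s"
    using in_s v2 sub by (intro vec.subspace_diff vec.subspace_scale)
  then have v1: "fr x1 y1 0 0 \<in> s"
    by (simp add: graph_def frame_scale frame_diff)
  have nz: "(x1, y1) \<noteq> (0, 0)"
    using indep1 by (simp add: graph_eq_0_iff)
  show ?thesis
    using is_line_eq_span2[OF s v1 v2 indep2_tline[OF nz]] by (simp add: tline_eq_span)
qed

text \<open>A long line carries \<open>q^n > q^2\<close> vectors of \<open>U\<close>, so vectors can
  be chosen successively outside 0, outside an F_q-line and outside an F_q-plane, as
  \<open>line_eq_tline\<close> requires.\<close>

lemma long_line_imp_tline:
  assumes "long_line \<iota> n U s"
  obtains x y where "(x, y) \<noteq> (0, 0)" "s = tline x y"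
proof -
  let ?q = "CARD('k)"
  have s: "is_line s" "vec.subspace s"
    using assms by (simp_all add: long_line_def is_line_def)
  then have card_s: "card (s \<inter> U) = ?q ^ n"
    using assms weight_eq_iff[OF emb subspace_U s(2)] by (simp add: long_line_def)
  have "?q > 1"
    by (rule CARD_base_gt_1[OF emb refl])
  then have less: "?q ^ k < card (s \<inter> U)" if "k < 3" for k
    using card_s n that by simp
  have pick: "\<exists>v. v \<in> s \<inter> U \<and> v \<notin> A" if "card A < card (s \<inter> U)" for A
  proof (rule ccontr)
    assume "\<not> ?thesis"
    then have "card (s \<inter> U) \<le> card A"
      by (intro card_mono) auto
    then show False
      using that by simp
  qed
  obtain v1 where v1: "v1 \<in> s \<inter> U" "v1 \<notin> {0}"
    using pick[of "{0}"] less[of 0] by auto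
  have "card (range (\<lambda>k. \<iota> k *s v1)) \<le> ?q"
    by (rule card_image_le) simp
  then obtain v2 where v2: "v2 \<in> s \<inter> U" "v2 \<notin> range (\<lambda>k. \<iota> k *s v1)"
    using pick[of "range (\<lambda>k. \<iota> k *s v1)"] less[of 1] by auto
  have "card ((\<lambda>(k, l). \<iota> k *s v1 + \<iota> l *s v2) ` UNIV) \<le> CARD('k \<times> 'k)"
    by (rule card_image_le) simp
  then obtain v3 where v3: "v3 \<in> s \<inter> U" "v3 \<notin> (\<lambda>(k, l). \<iota> k *s v1 + \<iota> l *s v2) ` UNIV"
    using pick[of "(\<lambda>(k, l). \<iota> k *s v1 + \<iota> l *s v2) ` UNIV"] less[of 2]
    by (auto simp: power2_eq_square)
  obtain x1 y1 x2 y2 x3 y3 where "v1 = graph x1 y1" "v2 = graph x2 y2" "v3 = graph x3 y3"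
    using v1(1) v2(1) v3(1) by (auto simp: U_def)
  note v = this
  have "s = tline x1 y1"
  proof (rule line_eq_tline[OF s(1), of x1 y1 x2 y2 x3 y3])
    show "graph x2 y2 \<noteq> \<iota> k *s graph x1 y1" for k
      using v v2(2) by blast
    show "graph x3 y3 \<noteq> \<iota> k *s graph x1 y1 + \<iota> l *s graph x2 y2" for k l
      using v v3(2) by (metis (mono_tags, lifting) UNIV_I case_prod_conv image_eqI)
  qed (use v v1 v2(1) v3(1) in auto)
  moreover have "(x1, y1) \<noteq> (0, 0)"
    using v v1(2) by (auto simp: graph_eq_0_iff)
  ultimately show ?thesis
    using that by blast
qed

section \<open>The pseudoregulus of q^n + 1 long lines\<close>

text \<open>Scaling the foot on \<open>axis1\<close> by \<open>c\<close> scales the foot on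
  \<open>axis2\<close> by \<open>\<sigma> c\<close>, so the line depends only on the projective
  point of \<open>(x, y)\<close>.\<close>

lemma tline_scale:
  assumes "c \<noteq> 0" "(x, y) \<noteq> (0, 0)"
  shows "tline (c * x) (c * y) = tline x y"
proof -
  have cxy: "(c * x, c * y) \<noteq> (0, 0)"
    using assms by auto
  have "fr (c * x) (c * y) 0 0 \<in> tline x y"
    using tline_memI(1)[of x y] vec.subspace_scale[of "tline x y" _ c]
    by (force simp: tline_eq_span frame_scale)
  moreover have "fr 0 0 (\<sigma> (c * x)) (\<sigma> (c * y)) \<in> tline x y"
    using tline_memI(2)[of x y] vec.subspace_scale[of "tline x y" _ "\<sigma> c"]
    by (force simp: tline_eq_span frame_scale \<sigma>_mult)
  ultimately show ?thesis
    using is_line_unique[OF is_line_tline[OF cxy] is_line_tline[OF assms(2)] tline_memI]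
      indep2_tline[OF cxy] by blast
qed

text \<open>A common nonzero vector has a nonzero part along one axis. Proportionality of
  \<open>(x, y)\<close> and \<open>(x', y')\<close> is read off there directly, or on
  \<open>axis2\<close> after undoing \<open>\<sigma>\<close>.\<close>

lemma tline_meet:
  assumes "(x, y) \<noteq> (0, 0)" "(x', y') \<noteq> (0, 0)" "v \<in> tline x y" "v \<in> tline x' y'" "v \<noteq> 0"
  shows "tline x y = tline x' y'"
proof -
  obtain \<alpha> \<beta> where v: "v = fr (\<alpha> * x) (\<alpha> * y) (\<beta> * \<sigma> x) (\<beta> * \<sigma> y)"
    using assms(3) unfolding tline_def by blast
  obtain \<alpha>' \<beta>' where "v = fr (\<alpha>' * x') (\<alpha>' * y') (\<beta>' * \<sigma> x') (\<beta>' * \<sigma> y')"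
    using assms(4) unfolding tline_def by blast
  with v have eq: "\<alpha> * x = \<alpha>' * x'" "\<alpha> * y = \<alpha>' * y'" "\<beta> * \<sigma> x = \<beta>' * \<sigma> x'" "\<beta> * \<sigma> y = \<beta>' * \<sigma> y'"
    by (simp_all add: fr_eq_iff)
  obtain c where c: "x = c * x'" "y = c * y'"
  proof (cases "\<alpha> = 0")
    case False
    then have "x = \<alpha>' / \<alpha> * x'" "y = \<alpha>' / \<alpha> * y'"
      using eq by (simp_all add: field_simps)
    then show ?thesis
      by (rule that)
  next
    case True
    then have "\<beta> \<noteq> 0"
      using v assms(5) by (auto simp: frame_0)
    obtain c where c: "\<beta>' / \<beta> = \<sigma> c"
      by (rule \<sigma>_surj)
    have "\<sigma> x = \<beta>' / \<beta> * \<sigma> x'" "\<sigma> y = \<beta>' / \<beta> * \<sigma> y'"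
      using eq \<open>\<beta> \<noteq> 0\<close> by (simp_all add: field_simps)
    then have "\<sigma> x = \<sigma> (c * x')" "\<sigma> y = \<sigma> (c * y')"
      by (simp_all only: c \<sigma>_mult)
    then show ?thesis
      using that[of c] bij_is_inj[OF \<sigma>_bij] by (simp add: inj_eq)
  qed
  moreover have "c \<noteq> 0"
    using assms(1) c by auto
  ultimately show ?thesis
    using tline_scale assms(2) by simp
qed

definition tlines :: "('a^4) set set" where
  "tlines = {tline x y |x y. (x, y) \<noteq> (0, 0)}"

lemma tline_in_tlines: "(x, y) \<noteq> (0, 0) \<Longrightarrow> tline x y \<in> tlines"
  unfolding tlines_def by blast

lemma card_tlines: "card tlines = CARD('k) ^ n + 1"
proof -
  \<comment> \<open>These are the normalised representatives of the points of a projective line over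
    the big field.\<close>
  have "tlines = insert (tline 1 0) (range (\<lambda>x. tline x 1))"
  proof
    show "tlines \<subseteq> insert (tline 1 0) (range (\<lambda>x. tline x 1))"
    proof
      fix s assume "s \<in> tlines"
      then obtain x y where xy: "(x, y) \<noteq> (0, 0)" "s = tline x y"
        by (auto simp: tlines_def)
      then show "s \<in> insert (tline 1 0) (range (\<lambda>x. tline x 1))"
        using tline_scale[of x 1 0] tline_scale[of y "x / y" 1] by (cases "y = 0") auto
    qed
  qed (auto intro!: tline_in_tlines)
  moreover have "tline 1 0 \<notin> range (\<lambda>x. tline x 1)"
  proof
    assume "tline 1 0 \<in> range (\<lambda>x. tline x 1)"
    then obtain x where "tline 1 0 = tline x 1"
      by blast
    then have "fr 1 0 0 0 \<in> tline x 1"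
      using tline_memI(1)[of 1 0] by simp
    then show False
      by (auto simp: tline_def fr_eq_iff)
  qed
  moreover have "inj (\<lambda>x. tline x 1)"
  proof (rule injI)
    fix x x' assume "tline x 1 = tline x' 1"
    then have "fr x 1 0 0 \<in> tline x' 1"
      using tline_memI(1)[of x 1] by simp
    then show "x = x'"
      by (auto simp: tline_def fr_eq_iff)
  qed
  ultimately show ?thesis
    by (simp add: card_image CARD_ext)
qed

lemma disjnt_points_iff:
  assumes "is_line T"
  shows "disjnt (points T) (linear_set A) \<longleftrightarrow> T \<inter> A \<subseteq> {0}"
  using assms by (simp add: is_line_def disjnt_linear_set_iff)

lemma pairwise_disjnt_tlines: "pairwise (\<lambda>s t. disjnt (points s) (points t)) tlines"
proof (rule pairwiseI)
  fix s t assume "s \<in> tlines" "t \<in> tlines" "s \<noteq> t"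
  moreover from this obtain x y x' y' where xy: "(x, y) \<noteq> (0, 0)" "(x', y') \<noteq> (0, 0)"
    and st: "s = tline x y" "t = tline x' y'"
    unfolding tlines_def by blast
  ultimately have "s \<inter> t \<subseteq> {0}"
    using tline_meet[OF xy] by blast
  then show "disjnt (points s) (points t)"
    using disjnt_points_iff[OF is_line_tline[OF xy(1)]] st(1) by simp
qed

text \<open>
  The four points \<open>(1,0)\<close>, \<open>(0,1)\<close>, \<open>(1,1)\<close>, \<open>(c,1)\<close> with \<open>c \<notin> F\<^sub>q\<close> already determine the transversals.
\<close>

lemma transversal_imp_axis:
  assumes T: "is_line T" and meet: "\<And>s. s \<in> tlines \<Longrightarrow> \<not> disjnt (points T) (points s)"
  shows "T = axis1 \<or> T = axis2"
proof -
  have sub: "vec.subspace T"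
    using T by (simp add: is_line_def)
  have hit: "\<exists>\<alpha> \<beta>. fr (\<alpha> * x) (\<alpha> * y) (\<beta> * \<sigma> x) (\<beta> * \<sigma> y) \<in> T \<and> (\<alpha> \<noteq> 0 \<or> \<beta> \<noteq> 0)"
    if "(x, y) \<noteq> (0, 0)" for x y
  proof -
    have "\<not> T \<inter> tline x y \<subseteq> {0}"
      using meet[of "tline x y"] that disjnt_points_iff[OF T] unfolding tlines_def by blast
    then obtain \<alpha> \<beta> where v: "fr (\<alpha> * x) (\<alpha> * y) (\<beta> * \<sigma> x) (\<beta> * \<sigma> y) \<in> T"
      "fr (\<alpha> * x) (\<alpha> * y) (\<beta> * \<sigma> x) (\<beta> * \<sigma> y) \<noteq> 0"
      unfolding tline_def by blast
    then have "\<alpha> \<noteq> 0 \<or> \<beta> \<noteq> 0"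
      by (auto simp: frame_0)
    then show ?thesis
      using v by blast
  qed
  obtain \<alpha>1 \<beta>1 where h1: "fr \<alpha>1 0 \<beta>1 0 \<in> T" "\<alpha>1 \<noteq> 0 \<or> \<beta>1 \<noteq> 0"
    using hit[of 1 0] by (auto simp: \<sigma>_0 \<sigma>_1)
  obtain \<alpha>2 \<beta>2 where h2: "fr 0 \<alpha>2 0 \<beta>2 \<in> T" "\<alpha>2 \<noteq> 0 \<or> \<beta>2 \<noteq> 0"
    using hit[of 0 1] by (auto simp: \<sigma>_0 \<sigma>_1)
  have "indep2 (fr \<alpha>1 0 \<beta>1 0) (fr 0 \<alpha>2 0 \<beta>2)"
    using h1 h2 by (auto simp: indep2_def frame_scale frame_add fr_eq_0_iff)
  then have "T = vec.span {fr \<alpha>1 0 \<beta>1 0, fr 0 \<alpha>2 0 \<beta>2}"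
    using T h1 h2 is_line_eq_span2 by blast
  then have T_eq: "T = {fr (l * \<alpha>1) (m * \<alpha>2) (l * \<beta>1) (m * \<beta>2) |l m. True}"
    by (simp add: span2_eq frame_scale frame_add)
  obtain \<alpha>3 \<beta>3 where "fr \<alpha>3 \<alpha>3 \<beta>3 \<beta>3 \<in> T" "\<alpha>3 \<noteq> 0 \<or> \<beta>3 \<noteq> 0"
    using hit[of 1 1] by (auto simp: \<sigma>_1)
  then obtain l m where lm: "l * \<alpha>1 = m * \<alpha>2" "l * \<beta>1 = m * \<beta>2" "l * \<alpha>1 \<noteq> 0 \<or> l * \<beta>1 \<noteq> 0"
    by (auto simp: T_eq fr_eq_iff)
  then have "l \<noteq> 0" "m \<noteq> 0"
    by auto
  \<comment> \<open>The first three lines leave only candidates for \<open>T\<close> consisting of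
    all \<open>fr (s * \<alpha>2) (t * \<alpha>2) (s * \<beta>2) (t * \<beta>2)\<close>; a fourth
    one selects the axes among them.\<close>
  define e where "e = m / l"
  have e: "\<alpha>1 = e * \<alpha>2" "\<beta>1 = e * \<beta>2" "e \<noteq> 0"
    using lm \<open>l \<noteq> 0\<close> \<open>m \<noteq> 0\<close> by (simp_all add: e_def field_simps)
  have "card (range \<iota>) < CARD('a)"
  proof -
    have "CARD('k) > 1"
      by (rule CARD_base_gt_1[OF emb refl])
    then have "CARD('k) ^ 1 < CARD('k) ^ n"
      using n by (intro power_strict_increasing) auto
    then show ?thesis
      using card_range_embedding[OF emb refl] CARD_ext by simp
  qed
  then obtain c where "c \<notin> range \<iota>"
    by (metis UNIV_eq_I less_irrefl)
  then have c: "\<sigma> c \<noteq> c"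
    using \<sigma>_fixed by simp
  obtain \<alpha>4 \<beta>4 where h4: "fr (\<alpha>4 * c) \<alpha>4 (\<beta>4 * \<sigma> c) \<beta>4 \<in> T" "\<alpha>4 \<noteq> 0 \<or> \<beta>4 \<noteq> 0"
    using hit[of c 1] by (auto simp: \<sigma>_1)
  then obtain l' m' where lm': "\<alpha>4 * c = l' * e * \<alpha>2" "\<alpha>4 = m' * \<alpha>2"
      "\<beta>4 * \<sigma> c = l' * e * \<beta>2" "\<beta>4 = m' * \<beta>2"
    by (auto simp: T_eq fr_eq_iff e(1,2) mult.assoc)
  have "m' \<noteq> 0"
    using lm' h4(2) by auto
  have "\<alpha>2 = 0 \<or> \<beta>2 = 0"
  proof (rule ccontr)
    assume nz: "\<not> ?thesis"
    \<comment> \<open>Cancelling \<open>\<alpha>2\<close> and \<open>\<beta>2\<close> equates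
      \<open>m' * c\<close> with \<open>m' * \<sigma> c\<close>, against the choice of
      \<open>c\<close>.\<close>
    then have "m' * c = l' * e" "m' * \<sigma> c = l' * e"
      using lm' by (simp_all add: algebra_simps)
    then show False
      using c \<open>m' \<noteq> 0\<close> by (metis mult_left_cancel)
  qed
  then consider "\<alpha>2 = 0" "\<beta>2 \<noteq> 0" | "\<alpha>2 \<noteq> 0" "\<beta>2 = 0"
    using h2(2) by blast
  then show ?thesis
  proof cases
    case 1
    then have "fr 0 0 (e * \<beta>2) 0 \<in> T" "fr 0 0 0 \<beta>2 \<in> T" "indep2 (fr 0 0 (e * \<beta>2) 0) (fr 0 0 0 \<beta>2)"
      using h1 h2 e by (auto simp: indep2_def frame_scale frame_add fr_eq_0_iff)
    moreover have "fr 0 0 (e * \<beta>2) 0 \<in> axis2" "fr 0 0 0 \<beta>2 \<in> axis2"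
      by (auto simp: axis2_def)
    ultimately show ?thesis
      using is_line_unique[OF T is_line_axis2] by blast
  next
    case 2
    then have "fr (e * \<alpha>2) 0 0 0 \<in> T" "fr 0 \<alpha>2 0 0 \<in> T" "indep2 (fr (e * \<alpha>2) 0 0 0) (fr 0 \<alpha>2 0 0)"
      using h1 h2 e by (auto simp: indep2_def frame_scale frame_add fr_eq_0_iff)
    moreover have "fr (e * \<alpha>2) 0 0 0 \<in> axis1" "fr 0 \<alpha>2 0 0 \<in> axis1"
      by (auto simp: axis1_def)
    ultimately show ?thesis
      using is_line_unique[OF T is_line_axis1] by blast
  qed
qed

section \<open>The axes as the only transversals\<close>

lemma axes_disjnt_U: "disjnt (points axis1) (linear_set U)" "disjnt (points axis2) (linear_set U)"
  unfolding disjnt_points_iff[OF is_line_axis1] disjnt_points_iff[OF is_line_axis2]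
  using b by (auto simp: axis1_def axis2_def U_def graph_def fr_eq_iff \<sigma>_eq_0_iff \<sigma>_0 frame_0)

lemma axes_meet_tlines:
  assumes "s \<in> tlines"
  shows "\<not> disjnt (points axis1) (points s)" "\<not> disjnt (points axis2) (points s)"
proof -
  obtain x y where xy: "(x, y) \<noteq> (0, 0)" "s = tline x y"
    using assms by (auto simp: tlines_def)
  have "fr x y 0 0 \<in> axis1" "fr x y 0 0 \<noteq> 0" "fr 0 0 (\<sigma> x) (\<sigma> y) \<in> axis2" "fr 0 0 (\<sigma> x) (\<sigma> y) \<noteq> 0"
    using xy(1) by (auto simp: axis1_def axis2_def fr_eq_0_iff \<sigma>_eq_0_iff)
  then show "\<not> disjnt (points axis1) (points s)" "\<not> disjnt (points axis2) (points s)"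
    unfolding disjnt_points_iff[OF is_line_axis1] disjnt_points_iff[OF is_line_axis2]
    using tline_memI[of x y] xy(2) by blast+
qed

lemma transversals_tlines:
  "{T. is_line T \<and> disjnt (points T) (linear_set U) \<and> (\<forall>s\<in>tlines. \<not> disjnt (points T) (points s))}
    = {axis1, axis2}"
  using transversal_imp_axis is_line_axis1 is_line_axis2 axes_disjnt_U axes_meet_tlines by auto

lemma transversal_lines_axes: "transversal_lines \<iota> n U axis1 axis2"
  unfolding transversal_lines_def
  using long_line_tline card_tlines pairwise_disjnt_tlines axes_neq transversals_tlines
  by (intro exI[of _ tlines]) (auto simp: tlines_def)

text \<open>The definition admits any suitable set \<open>S\<close> of long lines, but all long
  lines lie in \<open>tlines\<close>, so its cardinality forces \<open>S = tlines\<close>.\<close>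

lemma transversal_lines_imp_axes:
  assumes "transversal_lines \<iota> n U T1 T2"
  shows "{T1, T2} = {axis1, axis2}"
proof -
  obtain S where S: "\<forall>s\<in>S. long_line \<iota> n U s" "card S = CARD('k) ^ n + 1"
    and T: "{T. is_line T \<and> disjnt (points T) (linear_set U) \<and>
              (\<forall>s\<in>S. \<not> disjnt (points T) (points s))} = {T1, T2}"
    using assms unfolding transversal_lines_def by blast
  have "S \<subseteq> tlines"
    using S(1) long_line_imp_tline unfolding tlines_def by blast
  then have "S = tlines"
    using S(2) card_tlines by (intro card_subset_eq) auto
  then show ?thesis
    using T transversals_tlines by simp
qed

section \<open>The axes with respect to the quadric and its polarity\<close>

lemma external_line_axes:
  assumes "\<And>z. d \<noteq> z ^ 2"
  shows "external_line axis1" "external_line axis2"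
proof -
  have quad: "x = 0 \<and> y = 0" if "d * x ^ 2 = y ^ 2" for x y
  proof -
    have "x = 0"
    proof (rule ccontr)
      assume "x \<noteq> 0"
      then have "d = (y / x) ^ 2"
        using that by (simp add: field_simps)
      then show False
        using assms by blast
    qed
    then show ?thesis
      using that by simp
  qed
  \<comment> \<open>In this form the criterion for disjoint linear sets applies to the
    quadric.\<close>
  have quadric: "quadric = linear_set {v::'a^4. quadratic_form v = 0}"
    by (auto simp: quadric_def linear_set_def)
  show "external_line axis1" "external_line axis2"
    unfolding external_line_def quadric disjnt_points_iff[OF is_line_axis1]
      disjnt_points_iff[OF is_line_axis2]
    using is_line_axis1 is_line_axis2
    by (auto simp: axis1_def axis2_def quadratic_form_frame fr_eq_0_iff dest: quad quad[OF sym])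
qed

text \<open>The polar form is diagonal in the frame with entries \<open>2 * d\<close> and 2 up to
  sign, so testing against the two basis vectors of an axis kills exactly the coordinates along
  it.\<close>

lemma polar_axes: "polar_subspace axis1 = axis2" "polar_subspace axis2 = axis1"
proof -
  have "fr x y z w \<in> polar_subspace axis1 \<longleftrightarrow> fr x y z w \<in> axis2" for x y z w
  proof
    assume "fr x y z w \<in> polar_subspace axis1"
    then have "polar_form (fr x y z w) (fr 1 0 0 0) = 0" "polar_form (fr x y z w) (fr 0 1 0 0) = 0"
      unfolding polar_subspace_def axis1_def by blast+
    then show "fr x y z w \<in> axis2"
      using two d by (auto simp: polar_form_frame axis2_def fr_eq_iff)
  qed (auto simp: polar_subspace_def axis1_def axis2_def polar_form_frame fr_eq_iff)
  then show "polar_subspace axis1 = axis2"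
    by (metis fr_surj subset_antisym subsetI)
  have "fr x y z w \<in> polar_subspace axis2 \<longleftrightarrow> fr x y z w \<in> axis1" for x y z w
  proof
    assume "fr x y z w \<in> polar_subspace axis2"
    then have "polar_form (fr x y z w) (fr 0 0 1 0) = 0" "polar_form (fr x y z w) (fr 0 0 0 1) = 0"
      unfolding polar_subspace_def axis2_def by blast+
    then show "fr x y z w \<in> axis1"
      using two d by (auto simp: polar_form_frame axis1_def fr_eq_iff)
  qed (auto simp: polar_subspace_def axis1_def axis2_def polar_form_frame fr_eq_iff)
  then show "polar_subspace axis2 = axis1"
    by (metis fr_surj subset_antisym subsetI)
qed

end

section \<open>Transfer to the linear set of the theorem\<close>

lemma linear_set_D_B:
  fixes \<iota> :: "'k::field \<Rightarrow> 'a::field"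
  assumes "B_map q b r 0 = (0::'a)"
  shows "linear_set (D_B \<iota> q b r \<xi>) =
    {vec.span {vector [x, y, B_map q b r y, \<iota> \<xi> * B_map q b r x] :: 'a^4} |x y. (x, y) \<noteq> (0, 0)}"
proof -
  have "(vector [x, y, B_map q b r y, \<iota> \<xi> * B_map q b r x] :: 'a^4) = 0 \<longleftrightarrow> (x, y) = (0, 0)" for x y
    using assms by (auto simp: vec_4_eq_iff vector_4_nth)
  then show ?thesis
    unfolding linear_set_def D_B_def by blast
qed

theorem theorem4p6:
  fixes \<iota> :: "'k::{field,finite} \<Rightarrow> 'a::{field,finite}"
    and q n :: nat and r :: int and \<xi> :: 'k and b :: 'a
  assumes "field_embedding \<iota>"
    and "CARD('k) = q" and "CARD('a) = q ^ n"
    and "odd q" and "n \<ge> 3" and "odd n"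
    and "\<not> (\<exists>z. \<xi> = z ^ 2)"
    and "gcd (int n) r = 1"
    and "b \<noteq> 0" and "field_norm q n b \<noteq> 1" and "field_norm q n b \<noteq> -1"
  shows "linear_set (D_B \<iota> q b r \<xi>) =
           {vec.span {vector [x, y, B_map q b r y, \<iota> \<xi> * B_map q b r x] :: 'a^4} |x y. (x, y) \<noteq> (0, 0)}
       \<and> maximum_scattered \<iota> n (D_B \<iota> q b r \<xi>)
       \<and> pseudoregulus_type \<iota> n (D_B \<iota> q b r \<xi>)
       \<and> (\<forall>T1 T2. transversal_lines \<iota> n (D_B \<iota> q b r \<xi>) T1 T2 \<longrightarrow>
             external_line T1 \<and> external_line T2 \<and>
             polar_subspace T1 = T2 \<and> polar_subspace T2 = T1)"
proof -
  note emb = assms(1) and q = assms(2) and qn = assms(3)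
  have n_pos: "n > 0"
    using assms(5) by simp
  have two: "(2::'a) \<noteq> 0"
    using two_neq_zero[OF emb q qn n_pos] assms(4) .
  have nonsquare: "\<iota> \<xi> \<noteq> z ^ 2" for z
    using embedding_nonsquare[OF emb q qn n_pos assms(6) two assms(7)] .
  obtain k where k: "frob q r = (\<lambda>x::'a. x ^ (q ^ k))" "coprime n k"
    using frob_eq_power[OF emb q qn n_pos assms(8)] .
  have "bij (\<lambda>x::'a. x ^ (q ^ k))"
  proof -
    have "x = y" if "x ^ (q ^ k) = y ^ (q ^ k)" for x y :: 'a
      using that power_CARD_power_add[OF emb q, of "x - y" y k] by simp
    then have "inj (\<lambda>x::'a. x ^ (q ^ k))"
      by (rule injI)
    then show ?thesis
      by (simp add: bij_def finite_UNIV_inj_surj)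
  qed
  \<comment> \<open>\<open>nonsquare[of 0]\<close> supplies that \<open>\<iota> \<xi>\<close> is
    nonzero.\<close>
  then interpret semilinear_frame \<iota> n "\<lambda>x. x ^ (q ^ k)" b "\<iota> \<xi>"
    using power_CARD_power_add[OF emb q] power_fixed_iff_range_embedding[OF emb q qn n_pos k(2)]
      emb qn q two nonsquare[of 0] assms(5,9)
    by unfold_locales (simp_all add: power_mult_distrib)
  have H: "H_map q b r = (\<lambda>x. x - b * x ^ (q ^ k))"
    by (simp add: fun_eq_iff H_map_def k(1))
  then have bij_H: "bij (H_map q b r)"
    using bij_diff_mult_power[OF emb q qn n_pos assms(10)] by simp
  \<comment> \<open>At \<open>H x\<close> the map \<open>B\<close> takes the value
    \<open>2 * x - H x\<close>, which reverses the sign of the Frobenius term.\<close>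
  have B: "B_map q b r (H_map q b r x) = x + b * x ^ (q ^ k)" for x
    unfolding B_map_def inv_f_f[OF bij_is_inj[OF bij_H]] by (simp add: H)
  have graph: "vector [H_map q b r x, H_map q b r y, B_map q b r (H_map q b r y),
      \<iota> \<xi> * B_map q b r (H_map q b r x)] = graph x y" for x y
    unfolding B by (simp add: graph_def frame_def H)
  have D_B: "D_B \<iota> q b r \<xi> = U"
  proof
    show "U \<subseteq> D_B \<iota> q b r \<xi>"
      unfolding U_def D_B_def graph[symmetric] by blast
    show "D_B \<iota> q b r \<xi> \<subseteq> U"
    proof
      fix v assume "v \<in> D_B \<iota> q b r \<xi>"
      then obtain x y where v: "v = vector [x, y, B_map q b r y, \<iota> \<xi> * B_map q b r x]"
        unfolding D_B_def by blast
      \<comment> \<open>Surjectivity of \<open>H\<close> makes the substitution reach every vector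
        of the set.\<close>
      obtain x' y' where "x = H_map q b r x'" "y = H_map q b r y'"
        using bij_is_surj[OF bij_H] by (metis surjD)
      then show "v \<in> U"
        unfolding v by (simp add: graph)
    qed
  qed
  have "B_map q b r 0 = 0"
    using B[of 0] \<sigma>_0 by (simp add: H)
  note linear_set = linear_set_D_B[OF this, of \<iota> \<xi>, unfolded D_B]
  have "pseudoregulus_type \<iota> n U"
    unfolding pseudoregulus_type_def using maximum_scattered_U transversal_lines_axes by blast
  moreover have "external_line T1 \<and> external_line T2 \<and>
      polar_subspace T1 = T2 \<and> polar_subspace T2 = T1" if T: "transversal_lines \<iota> n U T1 T2" for T1 T2
  proof -
    consider "T1 = axis1" "T2 = axis2" | "T1 = axis2" "T2 = axis1"
      using transversal_lines_imp_axes[OF T] by (auto simp: doubleton_eq_iff)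
    then show ?thesis
      by cases (simp_all add: external_line_axes[OF nonsquare] polar_axes)
  qed
  ultimately show ?thesis
    using linear_set maximum_scattered_U unfolding D_B by simp
qed

end
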